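(* Let $(A,\mu,\alpha)$ be a Hom-alternative algebra over $\mathbf{k}$. Then $A$ is Hom-Maltsev-admissible, i.e., its commutator Hom-algebra $A^- = (A,[-,-],\alpha)$, where $[x,y]=\mu(x,y)-\mu(y,x)$, is a Hom-Maltsev algebra.
   Context: $\mathbf{k}$ is a fixed field of characteristic $0$; all modules, linear maps and tensor products are over $\mathbf{k}$. A Hom-algebra is a triple $(A,\mu,\alpha)$ with $A$ a $\mathbf{k}$-module, $\mu\colon A\otimes A\to A$ bilinear (not necessarily associative or unital), and $\alpha\colon A\to A$ linear with $\alpha(\mu(x,y))=\mu(\alpha(x),\alpha(y))$ for all $x,y$. The Hom-associator is $as_A(x,y,z)=\mu(\mu(x,y),\alpha(z))-\mu(\alpha(x),\mu(y,z))$. $A$ is Hom-alternative if $as_A$ is alternating (changes by the sign of the permutation when its arguments are permuted; equivalently in characteristic $0$, vanishes whenever two arguments are equal). For a Hom-algebra $(B,[-,-],\alpha)$, the Hom-Jacobian is $J_B(x,y,z)=[[x,y],\alpha(z)]+[[z,x],\alpha(y)]+[[y,z],\alpha(x)]$. A Hom-Maltsev algebra is a Hom-algebra $(B,[-,-],\alpha)$ with $[-,-]$ anti-symmetric and satisfying $J_B(\alpha(x),\alpha(y),[x,z])=[J_B(x,y,z),\alpha^2(x)]$ for all $x,y,z\in B$. *)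

theory Defs
  imports Complex_Main "HOL-Combinatorics.Permutations"
begin

text \<open>A bilinear map on \<open>A \<otimes> A\<close> is represented by its curried form, linear in each argument.\<close>

locale hom_algebra = vector_space scale
  for scale :: "'k::field_char_0 \<Rightarrow> 'a::ab_group_add \<Rightarrow> 'a" +
  fixes mu :: "'a \<Rightarrow> 'a \<Rightarrow> 'a" and \<alpha> :: "'a \<Rightarrow> 'a"
  assumes linear_left: "Vector_Spaces.linear scale scale (\<lambda>x. mu x y)"
    and linear_right: "Vector_Spaces.linear scale scale (\<lambda>y. mu x y)"
    and linear_twist: "Vector_Spaces.linear scale scale \<alpha>"
    and multiplicative: "\<alpha> (mu x y) = mu (\<alpha> x) (\<alpha> y)"

definition hom_associator ::
    "('a::ab_group_add \<Rightarrow> 'a \<Rightarrow> 'a) \<Rightarrow> ('a \<Rightarrow> 'a) \<Rightarrow> 'a \<Rightarrow> 'a \<Rightarrow> 'a \<Rightarrow> 'a" where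
  "hom_associator mu \<alpha> x y z = mu (mu x y) (\<alpha> z) - mu (\<alpha> x) (mu y z)"

text \<open>The arguments of a trilinear map are indexed by \<open>{..<3}\<close>; the values of the family \<open>v\<close>
  outside this set are irrelevant.\<close>

definition alternating3 ::
    "('k::field \<Rightarrow> 'a::ab_group_add \<Rightarrow> 'a) \<Rightarrow> ('a \<Rightarrow> 'a \<Rightarrow> 'a \<Rightarrow> 'a) \<Rightarrow> bool" where
  "alternating3 scale f \<longleftrightarrow>
     (\<forall>p (v :: nat \<Rightarrow> 'a). p permutes {..<3} \<longrightarrow>
        f (v (p 0)) (v (p 1)) (v (p 2)) = scale (of_int (sign p)) (f (v 0) (v 1) (v 2)))"

locale hom_alternative_algebra = hom_algebra scale mu \<alpha>
  for scale :: "'k::field_char_0 \<Rightarrow> 'a::ab_group_add \<Rightarrow> 'a"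
    and mu :: "'a \<Rightarrow> 'a \<Rightarrow> 'a" and \<alpha> :: "'a \<Rightarrow> 'a" +
  assumes alternating: "alternating3 scale (hom_associator mu \<alpha>)"

definition hom_jacobian ::
    "('a::ab_group_add \<Rightarrow> 'a \<Rightarrow> 'a) \<Rightarrow> ('a \<Rightarrow> 'a) \<Rightarrow> 'a \<Rightarrow> 'a \<Rightarrow> 'a \<Rightarrow> 'a" where
  "hom_jacobian br \<alpha> x y z = br (br x y) (\<alpha> z) + br (br z x) (\<alpha> y) + br (br y z) (\<alpha> x)"

locale hom_maltsev_algebra = hom_algebra scale br \<alpha>
  for scale :: "'k::field_char_0 \<Rightarrow> 'a::ab_group_add \<Rightarrow> 'a"
    and br :: "'a \<Rightarrow> 'a \<Rightarrow> 'a" and \<alpha> :: "'a \<Rightarrow> 'a" +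
  assumes antisymmetric: "br x y = - br y x"
    and hom_maltsev_identity:
      "hom_jacobian br \<alpha> (\<alpha> x) (\<alpha> y) (br x z) = br (hom_jacobian br \<alpha> x y z) ((\<alpha> ^^ 2) x)"

definition commutator :: "('a::ab_group_add \<Rightarrow> 'a \<Rightarrow> 'a) \<Rightarrow> 'a \<Rightarrow> 'a \<Rightarrow> 'a" where
  "commutator mu x y = mu x y - mu y x"

locale hom_maltsev_admissible = hom_algebra scale mu \<alpha>
  for scale :: "'k::field_char_0 \<Rightarrow> 'a::ab_group_add \<Rightarrow> 'a"
    and mu :: "'a \<Rightarrow> 'a \<Rightarrow> 'a" and \<alpha> :: "'a \<Rightarrow> 'a" +
  assumes commutator_maltsev: "hom_maltsev_algebra scale (commutator mu) \<alpha>"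

end

theory Submission
  imports Defs
begin

text \<open>
  Write \<open>(x, y, z)\<close> for the Hom-associator and suppress the twisting map. By alternativity the
  Hom-Jacobian of the commutator, which in any Hom-algebra is the signed sum of \<open>(x, y, z)\<close> over
  all six orderings, equals \<open>6 (x, y, z)\<close>. The Hom-Maltsev identity thus reduces to
  \<open>(x, y, [x, z]) = [(x, y, z), x]\<close>, which is the difference of the two Moufang-type identities
  \<open>(x, y, xz) = (x, y, z) x\<close> and \<open>(x, y, zx) = x (x, y, z)\<close>.

  Both of these say that the Hom version of the Bruck--Kleinfeld function,
  \<open>F(w, x, y, z) = (wx, y, z) - (x, y, z) w - x (w, y, z)\<close>, vanishes when two particular arguments
  are equal. Visibly \<open>F\<close> is alternating in \<open>y\<close> and \<open>z\<close>. Expanding associators gives, without any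
  alternativity, the five-term identity
  \<open>(wx, y, z) - (w, xy, z) + (w, x, yz) = (w, x, y) z + w (x, y, z)\<close>; adding it to its cyclic shift
  makes all but two products on the left cancel, and what remains is that \<open>F\<close> changes sign under a
  cyclic shift of its four arguments. A 4-cycle and an adjacent transposition are odd and generate
  the symmetric group, so \<open>F\<close> is alternating in all four arguments
  (\<open>kleinfeld_cyclic_shift\<close>, \<open>kleinfeld_eq_args\<close>).
\<close>

section \<open>Hom-algebras and their commutators\<close>

context hom_algebra
begin

lemma mu_add_left: "mu (a + b) c = mu a c + mu b c"
  using linear_left[of c] by (simp add: Vector_Spaces.linear_iff)

lemma mu_add_right: "mu a (b + c) = mu a b + mu a c"
  using linear_right[of a] by (simp add: Vector_Spaces.linear_iff)

lemma mu_scale_left: "mu (scale r a) b = scale r (mu a b)"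
  using linear_left[of b] by (simp add: Vector_Spaces.linear_iff)

lemma mu_scale_right: "mu a (scale r b) = scale r (mu a b)"
  using linear_right[of a] by (simp add: Vector_Spaces.linear_iff)

lemma mu_diff_left: "mu (a - b) c = mu a c - mu b c"
  using mu_add_left[of "a - b" b c] by (simp add: algebra_simps)

lemma mu_diff_right: "mu a (b - c) = mu a b - mu a c"
  using mu_add_right[of a "b - c" c] by (simp add: algebra_simps)

lemma mu_zero_left: "mu 0 a = 0"
  using mu_diff_left[of 0 0 a] by simp

lemma mu_zero_right: "mu a 0 = 0"
  using mu_diff_right[of a 0 0] by simp

lemma mu_minus_left: "mu (- a) b = - mu a b"
  using mu_diff_left[of 0 a b] by (simp add: mu_zero_left)

lemma mu_minus_right: "mu a (- b) = - mu a b"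
  using mu_diff_right[of a 0 b] by (simp add: mu_zero_right)

lemma twist_diff: "\<alpha> (a - b) = \<alpha> a - \<alpha> b"
proof -
  have "\<alpha> (c + b) = \<alpha> c + \<alpha> b" for c
    using linear_twist by (simp add: Vector_Spaces.linear_iff)
  from this[of "a - b"] show ?thesis by (simp add: algebra_simps)
qed

lemmas mu_linear = mu_add_left mu_add_right mu_diff_left mu_diff_right
  mu_minus_left mu_minus_right mu_zero_left mu_zero_right

abbreviation assoc :: "'a \<Rightarrow> 'a \<Rightarrow> 'a \<Rightarrow> 'a" where
  "assoc \<equiv> hom_associator mu \<alpha>"

lemma assoc_diff_right: "assoc x y (a - b) = assoc x y a - assoc x y b"
  by (simp add: hom_associator_def mu_linear twist_diff algebra_simps)

text \<open>The Hom version of the Teichmueller identity. The five associators are the edges of the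
  associativity pentagon, so each of the five bracketings of four factors occurs twice and cancels.
  Multiplicativity of the twist is what makes the two occurrences of \<open>(wx)(yz)\<close>, twisted as
  \<open>\<alpha> (wx) ((\<alpha> y) (\<alpha> z))\<close> and as \<open>((\<alpha> w) (\<alpha> x)) (\<alpha> (yz))\<close>, agree.\<close>

lemma five_term_identity:
  "assoc (mu w x) (\<alpha> y) (\<alpha> z) - assoc (\<alpha> w) (mu x y) (\<alpha> z) + assoc (\<alpha> w) (\<alpha> x) (mu y z)
     = mu (assoc w x y) (\<alpha> (\<alpha> z)) + mu (\<alpha> (\<alpha> w)) (assoc x y z)"
  by (simp add: hom_associator_def mu_linear multiplicative algebra_simps)

lemma jacobian_commutator:
  "hom_jacobian (commutator mu) \<alpha> x y z
     = assoc x y z + assoc y z x + assoc z x y - assoc y x z - assoc x z y - assoc z y x"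
  by (simp add: hom_jacobian_def commutator_def hom_associator_def mu_linear algebra_simps)

lemma commutator_scale_left:
  "commutator mu (scale r a) b = scale r (commutator mu a b)"
  by (simp add: commutator_def mu_scale_left mu_scale_right scale_right_diff_distrib)

lemma commutator_hom_algebra: "hom_algebra scale (commutator mu) \<alpha>"
proof (intro hom_algebra.intro hom_algebra_axioms.intro)
  show vs: "vector_space scale" by unfold_locales
  show "Vector_Spaces.linear scale scale (\<lambda>x. commutator mu x y)" for y
    by (simp add: Vector_Spaces.linear_iff vs commutator_def mu_add_left mu_add_right
          mu_scale_left mu_scale_right scale_right_diff_distrib)
  show "Vector_Spaces.linear scale scale (\<lambda>y. commutator mu x y)" for x
    by (simp add: Vector_Spaces.linear_iff vs commutator_def mu_add_left mu_add_right
          mu_scale_left mu_scale_right scale_right_diff_distrib)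
  show "Vector_Spaces.linear scale scale \<alpha>" by (rule linear_twist)
  show "\<alpha> (commutator mu x y) = commutator mu (\<alpha> x) (\<alpha> y)" for x y
    by (simp add: commutator_def twist_diff multiplicative)
qed

text \<open>The Bruck--Kleinfeld function: the deviation of \<open>(_, y, z)\<close> from a derivation, but with the
  factors of both products in the order opposite to the Leibniz rule. It is this order that makes
  the function alternating in an alternative algebra.\<close>

definition kleinfeld :: "'a \<Rightarrow> 'a \<Rightarrow> 'a \<Rightarrow> 'a \<Rightarrow> 'a" where
  "kleinfeld w x y z = assoc (mu w x) (\<alpha> y) (\<alpha> z)
     - mu (assoc x y z) (\<alpha> (\<alpha> w)) - mu (\<alpha> (\<alpha> x)) (assoc w y z)"

end

section \<open>Hom-alternative algebras\<close>

context hom_alternative_algebra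
begin

lemma assoc_swap_left: "assoc y x z = - assoc x y z"
proof -
  have "transpose 0 1 permutes {..<3::nat}"
    by (rule permutes_swap_id) auto
  moreover define v where "v = (\<lambda>i::nat. if i = 0 then x else if i = 1 then y else z)"
  ultimately have "assoc (v 1) (v 0) (v 2) = scale (- 1) (assoc (v 0) (v 1) (v 2))"
    using alternating[unfolded alternating3_def, rule_format, of "transpose 0 1" v]
    by (simp add: sign_swap_id transpose_def)
  then show ?thesis by (simp add: v_def)
qed

lemma assoc_swap_right: "assoc x z y = - assoc x y z"
proof -
  have "transpose 1 2 permutes {..<3::nat}"
    by (rule permutes_swap_id) auto
  moreover define v where "v = (\<lambda>i::nat. if i = 0 then x else if i = 1 then y else z)"
  ultimately have "assoc (v 0) (v 2) (v 1) = scale (- 1) (assoc (v 0) (v 1) (v 2))"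
    using alternating[unfolded alternating3_def, rule_format, of "transpose 1 2" v]
    by (simp add: sign_swap_id transpose_def)
  then show ?thesis by (simp add: v_def)
qed

lemma assoc_cyclic: "assoc y z x = assoc x y z"
  by (metis assoc_swap_left assoc_swap_right)

lemma assoc_eq_right: "assoc x y y = 0"
proof -
  have "scale 2 (assoc x y y) = scale (1 + 1) (assoc x y y)" by simp
  also have "\<dots> = assoc x y y + assoc x y y"
    by (simp only: scale_left_distrib scale_one)
  also have "\<dots> = assoc x y y + (- assoc x y y)"
    by (subst (2) assoc_swap_right) (rule refl)
  finally show ?thesis by simp
qed

lemma assoc_eq_left: "assoc x x y = 0"
  by (metis assoc_cyclic assoc_eq_right)

lemma kleinfeld_swap_right: "kleinfeld w x z y = - kleinfeld w x y z"
  unfolding kleinfeld_def assoc_swap_right[of _ z y] assoc_swap_right[of _ "\<alpha> z" "\<alpha> y"]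
  by (simp add: mu_minus_left mu_minus_right)

lemma kleinfeld_eq_right: "kleinfeld w x y y = 0"
  by (simp add: kleinfeld_def assoc_eq_right mu_linear)

text \<open>Moving the product into the first slot of each associator, the five-term identities for
  \<open>(w, x, y, z)\<close> and for \<open>(x, y, z, w)\<close> share the terms of the products \<open>x y\<close> and \<open>y z\<close>, with
  opposite signs. Their sum involves only \<open>w x\<close> and \<open>z w\<close>, one for each Kleinfeld function.\<close>

lemma kleinfeld_cyclic_shift: "kleinfeld z w x y = - kleinfeld w x y z"
proof -
  have five: "assoc (mu w x) (\<alpha> y) (\<alpha> z) - assoc (mu x y) (\<alpha> z) (\<alpha> w) + assoc (mu y z) (\<alpha> w) (\<alpha> x)
      = mu (assoc w x y) (\<alpha> (\<alpha> z)) + mu (\<alpha> (\<alpha> w)) (assoc x y z)" for w x y z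
    using five_term_identity[of w x y z] assoc_cyclic[of "mu x y" "\<alpha> z" "\<alpha> w"]
      assoc_cyclic[of "\<alpha> w" "\<alpha> x" "mu y z"] assoc_cyclic[of "\<alpha> w" "mu x y" "\<alpha> z"]
    by simp
  have "assoc (mu w x) (\<alpha> y) (\<alpha> z) + assoc (mu z w) (\<alpha> x) (\<alpha> y)
      = (assoc (mu w x) (\<alpha> y) (\<alpha> z) - assoc (mu x y) (\<alpha> z) (\<alpha> w) + assoc (mu y z) (\<alpha> w) (\<alpha> x))
      + (assoc (mu x y) (\<alpha> z) (\<alpha> w) - assoc (mu y z) (\<alpha> w) (\<alpha> x) + assoc (mu z w) (\<alpha> x) (\<alpha> y))"
    by simp
  also have "\<dots> = mu (assoc w x y) (\<alpha> (\<alpha> z)) + mu (\<alpha> (\<alpha> w)) (assoc x y z)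
      + (mu (assoc x y z) (\<alpha> (\<alpha> w)) + mu (\<alpha> (\<alpha> x)) (assoc y z w))"
    by (simp only: five)
  finally show ?thesis
    using assoc_cyclic[of y z w] assoc_cyclic[of z x y] assoc_cyclic[of y z x]
    by (simp add: kleinfeld_def algebra_simps)
qed

text \<open>Equal arguments can be carried to the last two places: adjacent ones by cyclic shifts alone,
  the first and the third after swapping the last two arguments.\<close>

lemma kleinfeld_eq_args:
  shows "kleinfeld z x x y = 0" and "kleinfeld x z x y = 0"
proof -
  have middle: "kleinfeld c a a b = 0" for a b c
    using kleinfeld_cyclic_shift[of b c a a] kleinfeld_eq_right[of b c a] by simp
  show "kleinfeld z x x y = 0" by (rule middle)
  show "kleinfeld x z x y = 0"
    using kleinfeld_swap_right[of x z y x] kleinfeld_cyclic_shift[of x x z y]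
      kleinfeld_cyclic_shift[of y x x z] middle[of y x z] by simp
qed

text \<open>The vanishing of \<open>F(x, z, x, y)\<close>: of the two products subtracted in it, one has a factor
  \<open>(x, x, y) = 0\<close>. The companion identity comes from \<open>F(z, x, x, y)\<close> in the same way.\<close>

lemma moufang_right: "assoc (\<alpha> x) (\<alpha> y) (mu x z) = mu (assoc x y z) (\<alpha> (\<alpha> x))"
proof -
  have "assoc (\<alpha> x) (\<alpha> y) (mu x z) = assoc (mu x z) (\<alpha> x) (\<alpha> y)"
    by (rule assoc_cyclic)
  also have "\<dots> = mu (assoc z x y) (\<alpha> (\<alpha> x))"
    using kleinfeld_eq_args(2)[of x z y] by (simp add: kleinfeld_def assoc_eq_left mu_zero_right)
  also have "assoc z x y = assoc x y z"
    by (rule assoc_cyclic[symmetric])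
  finally show ?thesis .
qed

lemma moufang_left: "assoc (\<alpha> x) (\<alpha> y) (mu z x) = mu (\<alpha> (\<alpha> x)) (assoc x y z)"
proof -
  have "assoc (\<alpha> x) (\<alpha> y) (mu z x) = assoc (mu z x) (\<alpha> x) (\<alpha> y)"
    by (rule assoc_cyclic)
  also have "\<dots> = mu (\<alpha> (\<alpha> x)) (assoc z x y)"
    using kleinfeld_eq_args(1)[of z x y] by (simp add: kleinfeld_def assoc_eq_left mu_zero_left)
  also have "assoc z x y = assoc x y z"
    by (rule assoc_cyclic[symmetric])
  finally show ?thesis .
qed

lemma jacobian_eq_six_assoc:
  "hom_jacobian (commutator mu) \<alpha> x y z = scale 6 (assoc x y z)"
proof -
  have "(6::'k) = 1 + 1 + 1 + 1 + 1 + 1" by simp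
  then have "scale 6 a = a + a + a + a + a + a" for a
    by (simp only: scale_left_distrib scale_one)
  then show ?thesis
    using assoc_cyclic[of x y z] assoc_cyclic[of z x y] assoc_swap_left[of x y z]
      assoc_swap_right[of x y z] assoc_swap_right[of z x y]
    by (simp add: jacobian_commutator)
qed

lemma commutator_hom_maltsev: "hom_maltsev_algebra scale (commutator mu) \<alpha>"
proof -
  interpret br: hom_algebra scale "commutator mu" \<alpha> by (rule commutator_hom_algebra)
  show ?thesis
  proof
    show "commutator mu x y = - commutator mu y x" for x y
      by (simp add: commutator_def)
    show "hom_jacobian (commutator mu) \<alpha> (\<alpha> x) (\<alpha> y) (commutator mu x z)
        = commutator mu (hom_jacobian (commutator mu) \<alpha> x y z) ((\<alpha> ^^ 2) x)" for x y z
    proof -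
      have "assoc (\<alpha> x) (\<alpha> y) (commutator mu x z) = commutator mu (assoc x y z) (\<alpha> (\<alpha> x))"
        by (simp add: commutator_def assoc_diff_right moufang_left moufang_right)
      then show ?thesis
        by (simp add: jacobian_eq_six_assoc commutator_scale_left numeral_2_eq_2)
    qed
  qed
qed

end

theorem theorem3p8:
  fixes scale :: "'k::field_char_0 \<Rightarrow> 'a::ab_group_add \<Rightarrow> 'a"
    and mu :: "'a \<Rightarrow> 'a \<Rightarrow> 'a"
    and \<alpha> :: "'a \<Rightarrow> 'a"
  assumes "hom_alternative_algebra scale mu \<alpha>"
  shows "hom_maltsev_admissible scale mu \<alpha>"
proof -
  interpret hom_alternative_algebra scale mu \<alpha> by (rule assms)
  show ?thesis
    by (intro hom_maltsev_admissible.intro hom_maltsev_admissible_axioms.intro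
        hom_algebra_axioms commutator_hom_maltsev)
qed

end
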